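(* (1) Let $(A,\mu)$ be a Maltsev-admissible algebra over $\mathbf{k}$ and $\alpha\colon A\to A$ be an algebra morphism. Then the induced Hom-algebra $A_\alpha=(A,\mu_\alpha=\alpha\circ\mu,\alpha)$ is a Hom-Maltsev-admissible algebra. (2) Let $(A,\mu,\alpha)$ be a Hom-Maltsev-admissible algebra over $\mathbf{k}$. Then the derived Hom-algebra $A^n=(A,\mu^{(n)},\alpha^{2^n})$, where $\mu^{(n)}=\alpha^{2^n-1}\circ\mu$, is also a Hom-Maltsev-admissible algebra for each $n\ge 0$.
   Context: $\mathbf{k}$ is a fixed field of characteristic $0$; all modules, linear maps and tensor products are over $\mathbf{k}$. An algebra $(A,\mu)$ is a $\mathbf{k}$-module with a bilinear multiplication (not necessarily associative or unital); an algebra morphism is a linear map $\alpha$ with $\alpha(\mu(x,y))=\mu(\alpha(x),\alpha(y))$. A Hom-algebra is a triple $(A,\mu,\alpha)$ with $(A,\mu)$ an algebra and $\alpha\colon A\to A$ an algebra morphism of $(A,\mu)$. For a Hom-algebra $(B,[-,-],\alpha)$, the Hom-Jacobian is $J_B(x,y,z)=[[x,y],\alpha(z)]+[[z,x],\alpha(y)]+[[y,z],\alpha(x)]$. A Hom-Maltsev algebra is a Hom-algebra $(B,[-,-],\alpha)$ with $[-,-]$ anti-symmetric and $J_B(\alpha(x),\alpha(y),[x,z])=[J_B(x,y,z),\alpha^2(x)]$ for all $x,y,z\in B$; a Maltsev algebra is the case $\alpha=\mathrm{Id}$. The commutator Hom-algebra of $(A,\mu,\alpha)$ is $A^-=(A,[-,-],\alpha)$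 with $[x,y]=\mu(x,y)-\mu(y,x)$. $(A,\mu,\alpha)$ is Hom-Maltsev-admissible if $A^-$ is a Hom-Maltsev algebra; an algebra $(A,\mu)$ is Maltsev-admissible if $(A,[-,-])$, with $[x,y]=\mu(x,y)-\mu(y,x)$, is a Maltsev algebra. Powers $\alpha^k$ denote $k$-fold composition, $\alpha^0=\mathrm{Id}$. *)

theory Defs
  imports Complex_Main
begin

text \<open>
  An algebra is carried by a whole type \<open>'a\<close>, which is a vector space over the field \<open>'k\<close> of
  characteristic 0 by means of \<open>scale\<close>. Its multiplication is neither associative nor unital.
\<close>

locale nonassoc_algebra = vector_space scale
  for scale :: "'k::field_char_0 \<Rightarrow> 'a::ab_group_add \<Rightarrow> 'a" +
  fixes mult :: "'a \<Rightarrow> 'a \<Rightarrow> 'a"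
  assumes linear_mult_left: "\<And>y. Vector_Spaces.linear scale scale (\<lambda>x. mult x y)"
    and linear_mult_right: "\<And>x. Vector_Spaces.linear scale scale (\<lambda>y. mult x y)"

definition algebra_morphism ::
  "('k::field_char_0 \<Rightarrow> 'a::ab_group_add \<Rightarrow> 'a) \<Rightarrow> ('a \<Rightarrow> 'a \<Rightarrow> 'a) \<Rightarrow> ('a \<Rightarrow> 'a) \<Rightarrow> bool"
  where "algebra_morphism scale mult \<alpha> \<longleftrightarrow>
    Vector_Spaces.linear scale scale \<alpha> \<and> (\<forall>x y. \<alpha> (mult x y) = mult (\<alpha> x) (\<alpha> y))"

locale hom_algebra = nonassoc_algebra scale mult
  for scale :: "'k::field_char_0 \<Rightarrow> 'a::ab_group_add \<Rightarrow> 'a"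
    and mult :: "'a \<Rightarrow> 'a \<Rightarrow> 'a" +
  fixes \<alpha> :: "'a \<Rightarrow> 'a"
  assumes morphism: "algebra_morphism scale mult \<alpha>"

definition hom_jacobian ::
  "('a::ab_group_add \<Rightarrow> 'a \<Rightarrow> 'a) \<Rightarrow> ('a \<Rightarrow> 'a) \<Rightarrow> 'a \<Rightarrow> 'a \<Rightarrow> 'a \<Rightarrow> 'a"
  where "hom_jacobian br \<alpha> x y z =
    br (br x y) (\<alpha> z) + br (br z x) (\<alpha> y) + br (br y z) (\<alpha> x)"

locale hom_maltsev_algebra = hom_algebra scale br \<alpha>
  for scale :: "'k::field_char_0 \<Rightarrow> 'a::ab_group_add \<Rightarrow> 'a"
    and br :: "'a \<Rightarrow> 'a \<Rightarrow> 'a"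
    and \<alpha> :: "'a \<Rightarrow> 'a" +
  assumes antisymmetric: "\<And>x y. br x y = - br y x"
    and hom_maltsev_identity:
      "\<And>x y z. hom_jacobian br \<alpha> (\<alpha> x) (\<alpha> y) (br x z) = br (hom_jacobian br \<alpha> x y z) ((\<alpha> ^^ 2) x)"

definition maltsev_algebra ::
  "('k::field_char_0 \<Rightarrow> 'a::ab_group_add \<Rightarrow> 'a) \<Rightarrow> ('a \<Rightarrow> 'a \<Rightarrow> 'a) \<Rightarrow> bool"
  where "maltsev_algebra scale br \<longleftrightarrow> hom_maltsev_algebra scale br id"

definition commutator :: "('a::ab_group_add \<Rightarrow> 'a \<Rightarrow> 'a) \<Rightarrow> 'a \<Rightarrow> 'a \<Rightarrow> 'a"
  where "commutator mult x y = mult x y - mult y x"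

definition maltsev_admissible ::
  "('k::field_char_0 \<Rightarrow> 'a::ab_group_add \<Rightarrow> 'a) \<Rightarrow> ('a \<Rightarrow> 'a \<Rightarrow> 'a) \<Rightarrow> bool"
  where "maltsev_admissible scale mult \<longleftrightarrow>
    nonassoc_algebra scale mult \<and> maltsev_algebra scale (commutator mult)"

definition hom_maltsev_admissible ::
  "('k::field_char_0 \<Rightarrow> 'a::ab_group_add \<Rightarrow> 'a) \<Rightarrow> ('a \<Rightarrow> 'a \<Rightarrow> 'a) \<Rightarrow> ('a \<Rightarrow> 'a) \<Rightarrow> bool"
  where "hom_maltsev_admissible scale mult \<alpha> \<longleftrightarrow>
    hom_algebra scale mult \<alpha> \<and> hom_maltsev_algebra scale (commutator mult) \<alpha>"

definition induced_mult :: "('a \<Rightarrow> 'a \<Rightarrow> 'a) \<Rightarrow> ('a \<Rightarrow> 'a) \<Rightarrow> 'a \<Rightarrow> 'a \<Rightarrow> 'a"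
  where "induced_mult mult \<alpha> x y = \<alpha> (mult x y)"

definition derived_mult :: "('a \<Rightarrow> 'a \<Rightarrow> 'a) \<Rightarrow> ('a \<Rightarrow> 'a) \<Rightarrow> nat \<Rightarrow> 'a \<Rightarrow> 'a \<Rightarrow> 'a"
  where "derived_mult mult \<alpha> n x y = (\<alpha> ^^ (2 ^ n - 1)) (mult x y)"

end

theory Submission
  imports Defs
begin

text \<open>
  Both parts are instances of one twisting principle, \<open>hom_maltsev_admissible_twist\<close>: if
  \<open>(A, \<mu>, \<alpha>)\<close> is Hom-Maltsev-admissible and \<open>\<beta>\<close> is a morphism of \<open>(A, \<mu>)\<close> that commutes with
  \<open>\<alpha>\<close>, then \<open>(A, \<beta> \<circ> \<mu>, \<beta> \<circ> \<alpha>)\<close> is Hom-Maltsev-admissible. A Maltsev-admissible algebra is the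
  case \<open>\<alpha> = id\<close>, and its twist by a morphism is the induced algebra. The \<open>n\<close>-th derived algebra is
  the twist of \<open>(A, \<mu>, \<alpha>)\<close> by \<open>\<beta> = \<alpha> ^^ (2 ^ n - 1)\<close>, because then \<open>\<beta> \<circ> \<alpha> = \<alpha> ^^ (2 ^ n)\<close>.

  The principle holds because twisting changes a monomial of the Hom-Maltsev identity only by a
  power of \<open>\<beta>\<close> in front of it, and this power depends only on the number of brackets.
  Each bracket of the twisted algebra brings one \<open>\<beta>\<close>, the map \<open>\<beta> \<circ> \<alpha>\<close> brings as many \<open>\<beta>\<close> as needed to keep the two factors of a bracket balanced, and \<open>\<beta>\<close> can be moved
  outwards past brackets and past \<open>\<alpha>\<close>. The Hom-Jacobian has two brackets in each term and
  acquires \<open>\<beta>\<^sup>2\<close> (\<open>hom_jacobian_twist\<close>); both sides of the Hom-Maltsev identity have three, so the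
  twisted identity is the image under \<open>\<beta>\<^sup>3\<close> of the original one (\<open>hom_maltsev_algebra_twist\<close>).
  Twisting moreover commutes with passing to the commutator, since \<open>\<beta>\<close> is additive.
\<close>

lemma algebra_morphism_mult:
  "algebra_morphism scale mult \<beta> \<Longrightarrow> \<beta> (mult x y) = mult (\<beta> x) (\<beta> y)"
  by (simp add: algebra_morphism_def)

lemma algebra_morphism_linear:
  "algebra_morphism scale mult \<beta> \<Longrightarrow> Vector_Spaces.linear scale scale \<beta>"
  by (simp add: algebra_morphism_def)

lemma algebra_morphism_add:
  "algebra_morphism scale mult \<beta> \<Longrightarrow> \<beta> (x + y) = \<beta> x + \<beta> y"
  by (rule Vector_Spaces.linear.axioms(3)[OF algebra_morphism_linear, THEN module_hom.add])

lemma algebra_morphism_diff: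
  "algebra_morphism scale mult \<beta> \<Longrightarrow> \<beta> (x - y) = \<beta> x - \<beta> y"
  by (rule Vector_Spaces.linear.axioms(3)[OF algebra_morphism_linear, THEN module_hom.diff])

lemma algebra_morphism_neg:
  "algebra_morphism scale mult \<beta> \<Longrightarrow> \<beta> (- x) = - \<beta> x"
  by (rule Vector_Spaces.linear.axioms(3)[OF algebra_morphism_linear, THEN module_hom.neg])

lemma algebra_morphism_funpow:
  assumes "vector_space scale" and "algebra_morphism scale mult \<alpha>"
  shows "algebra_morphism scale mult (\<alpha> ^^ n)"
proof (induction n)
  case 0
  show ?case
    using vector_space.linear_id[OF assms(1)] by (simp add: algebra_morphism_def id_def)
next
  case (Suc n)
  have "Vector_Spaces.linear scale scale (\<alpha> \<circ> \<alpha> ^^ n)"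
    using Suc assms(2) by (blast intro: Vector_Spaces.linear_compose algebra_morphism_linear)
  with Suc assms(2) show ?case
    by (simp add: algebra_morphism_def comp_def)
qed

lemma algebra_morphism_commutator:
  assumes "algebra_morphism scale mult \<beta>"
  shows "algebra_morphism scale (commutator mult) \<beta>"
  using assms
  by (simp add: algebra_morphism_def commutator_def algebra_morphism_diff[OF assms])

lemma commutator_induced_mult:
  assumes "algebra_morphism scale mult \<beta>"
  shows "commutator (induced_mult mult \<beta>) = induced_mult (commutator mult) \<beta>"
  by (simp add: fun_eq_iff commutator_def induced_mult_def algebra_morphism_diff[OF assms])

lemma hom_algebra_twist:
  assumes A: "hom_algebra scale mult \<alpha>" and \<beta>: "algebra_morphism scale mult \<beta>"
    and comm: "\<And>x. \<beta> (\<alpha> x) = \<alpha> (\<beta> x)"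
  shows "hom_algebra scale (induced_mult mult \<beta>) (\<beta> \<circ> \<alpha>)"
proof -
  interpret hom_algebra scale mult \<alpha> by (rule A)
  note lin = algebra_morphism_linear[OF \<beta>] algebra_morphism_linear[OF morphism]
  show ?thesis
  proof (intro hom_algebra.intro nonassoc_algebra.intro nonassoc_algebra_axioms.intro
      hom_algebra_axioms.intro vector_space_axioms)
    show "Vector_Spaces.linear scale scale (\<lambda>x. induced_mult mult \<beta> x y)" for y
      using Vector_Spaces.linear_compose[OF linear_mult_left[of y] lin(1)]
      by (simp add: induced_mult_def comp_def)
    show "Vector_Spaces.linear scale scale (\<lambda>y. induced_mult mult \<beta> x y)" for x
      using Vector_Spaces.linear_compose[OF linear_mult_right[of x] lin(1)]
      by (simp add: induced_mult_def comp_def)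
    show "algebra_morphism scale (induced_mult mult \<beta>) (\<beta> \<circ> \<alpha>)"
      using Vector_Spaces.linear_compose[OF lin(2,1)]
      by (simp add: algebra_morphism_def induced_mult_def comm
          algebra_morphism_mult[OF \<beta>] algebra_morphism_mult[OF morphism])
  qed
qed

text \<open>
  In \<open>\<beta> [\<beta> [x, y], \<beta> (\<alpha> z)]\<close> the inner product contributes one \<open>\<beta>\<close>, which its partner \<open>\<beta> (\<alpha> z)\<close>
  matches; so a second \<open>\<beta>\<close> can be taken out of the outer product.
\<close>

lemma hom_jacobian_twist:
  assumes "algebra_morphism scale br \<beta>"
  shows "hom_jacobian (induced_mult br \<beta>) (\<beta> \<circ> \<alpha>) x y z = \<beta> (\<beta> (hom_jacobian br \<alpha> x y z))"
  by (simp add: hom_jacobian_def induced_mult_def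
      algebra_morphism_add[OF assms] algebra_morphism_mult[OF assms])

lemma hom_jacobian_morphism:
  assumes "algebra_morphism scale br \<beta>" and "\<And>x. \<beta> (\<alpha> x) = \<alpha> (\<beta> x)"
  shows "\<beta> (hom_jacobian br \<alpha> x y z) = hom_jacobian br \<alpha> (\<beta> x) (\<beta> y) (\<beta> z)"
  by (simp add: hom_jacobian_def assms(2)
      algebra_morphism_add[OF assms(1)] algebra_morphism_mult[OF assms(1)])

theorem hom_maltsev_algebra_twist:
  assumes A: "hom_maltsev_algebra scale br \<alpha>" and \<beta>: "algebra_morphism scale br \<beta>"
    and comm: "\<And>x. \<beta> (\<alpha> x) = \<alpha> (\<beta> x)"
  shows "hom_maltsev_algebra scale (induced_mult br \<beta>) (\<beta> \<circ> \<alpha>)"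
proof -
  interpret hom_maltsev_algebra scale br \<alpha> by (rule A)
  let ?J = "hom_jacobian br \<alpha>" and ?br' = "induced_mult br \<beta>" and ?\<alpha>' = "\<beta> \<circ> \<alpha>"
  interpret twist: hom_algebra scale ?br' ?\<alpha>'
    by (rule hom_algebra_twist[OF hom_algebra_axioms \<beta> comm])
  show ?thesis
  proof
    show "?br' x y = - ?br' y x" for x y
      using antisymmetric[of x y] by (simp add: induced_mult_def algebra_morphism_neg[OF \<beta>])
    show "hom_jacobian ?br' ?\<alpha>' (?\<alpha>' x) (?\<alpha>' y) (?br' x z)
        = ?br' (hom_jacobian ?br' ?\<alpha>' x y z) ((?\<alpha>' ^^ 2) x)" for x y z
    proof -
      have "hom_jacobian ?br' ?\<alpha>' (?\<alpha>' x) (?\<alpha>' y) (?br' x z)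
          = \<beta> (\<beta> (?J (\<beta> (\<alpha> x)) (\<beta> (\<alpha> y)) (\<beta> (br x z))))"
        unfolding hom_jacobian_twist[OF \<beta>] by (simp add: induced_mult_def)
      also have "\<dots> = \<beta> (\<beta> (\<beta> (?J (\<alpha> x) (\<alpha> y) (br x z))))"
        by (simp only: hom_jacobian_morphism[where \<alpha> = \<alpha>, OF \<beta> comm])
      also have "\<dots> = \<beta> (\<beta> (\<beta> (br (?J x y z) ((\<alpha> ^^ 2) x))))"
        by (simp only: hom_maltsev_identity)
      also have "\<dots> = \<beta> (br (\<beta> (\<beta> (?J x y z))) (\<beta> (\<beta> ((\<alpha> ^^ 2) x))))"
        by (simp only: algebra_morphism_mult[OF \<beta>])
      also have "\<beta> (\<beta> ((\<alpha> ^^ 2) x)) = (?\<alpha>' ^^ 2) x"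
        by (simp add: numeral_2_eq_2 comm)
      finally show ?thesis
        unfolding hom_jacobian_twist[OF \<beta>] by (simp add: induced_mult_def)
    qed
  qed
qed

theorem hom_maltsev_admissible_twist:
  assumes "hom_maltsev_admissible scale mult \<alpha>" and "algebra_morphism scale mult \<beta>"
    and "\<And>x. \<beta> (\<alpha> x) = \<alpha> (\<beta> x)"
  shows "hom_maltsev_admissible scale (induced_mult mult \<beta>) (\<beta> \<circ> \<alpha>)"
  using assms hom_algebra_twist[of scale mult \<alpha> \<beta>]
    hom_maltsev_algebra_twist[of scale "commutator mult" \<alpha> \<beta>]
  by (simp add: hom_maltsev_admissible_def commutator_induced_mult algebra_morphism_commutator)

lemma maltsev_admissible_imp_hom_maltsev_admissible_id:
  assumes "maltsev_admissible scale mult"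
  shows "hom_maltsev_admissible scale mult id"
proof -
  interpret nonassoc_algebra scale mult
    using assms by (simp add: maltsev_admissible_def)
  have "algebra_morphism scale mult id"
    using linear_id by (simp add: algebra_morphism_def id_def)
  then have "hom_algebra scale mult id"
    by unfold_locales
  with assms show ?thesis
    by (simp add: hom_maltsev_admissible_def maltsev_admissible_def maltsev_algebra_def)
qed

theorem theorem4p5:
  fixes scale :: "'k::field_char_0 \<Rightarrow> 'a::ab_group_add \<Rightarrow> 'a"
  shows "(\<forall>\<mu> \<alpha>. maltsev_admissible scale \<mu> \<and> algebra_morphism scale \<mu> \<alpha> \<longrightarrow>
            hom_maltsev_admissible scale (induced_mult \<mu> \<alpha>) \<alpha>) \<and>
         (\<forall>\<mu> \<alpha>. hom_maltsev_admissible scale \<mu> \<alpha> \<longrightarrow>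
            (\<forall>n::nat. hom_maltsev_admissible scale (derived_mult \<mu> \<alpha> n) (\<alpha> ^^ (2 ^ n))))"
proof (intro conjI allI impI)
  fix \<mu> :: "'a \<Rightarrow> 'a \<Rightarrow> 'a" and \<alpha>
  assume "maltsev_admissible scale \<mu> \<and> algebra_morphism scale \<mu> \<alpha>"
  then show "hom_maltsev_admissible scale (induced_mult \<mu> \<alpha>) \<alpha>"
    using hom_maltsev_admissible_twist[of scale \<mu> id \<alpha>]
    by (simp add: maltsev_admissible_imp_hom_maltsev_admissible_id)
next
  fix \<mu> :: "'a \<Rightarrow> 'a \<Rightarrow> 'a" and \<alpha> and n :: nat
  assume A: "hom_maltsev_admissible scale \<mu> \<alpha>"
  then interpret hom_algebra scale \<mu> \<alpha>
    by (simp add: hom_maltsev_admissible_def)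
  let ?\<beta> = "\<alpha> ^^ (2 ^ n - 1)"
  have "algebra_morphism scale \<mu> ?\<beta>"
    by (rule algebra_morphism_funpow[OF vector_space_axioms morphism])
  then have "hom_maltsev_admissible scale (induced_mult \<mu> ?\<beta>) (?\<beta> \<circ> \<alpha>)"
    by (rule hom_maltsev_admissible_twist[OF A]) (simp add: funpow_swap1)
  moreover have "induced_mult \<mu> ?\<beta> = derived_mult \<mu> \<alpha> n"
    by (simp add: fun_eq_iff induced_mult_def derived_mult_def)
  moreover have "?\<beta> \<circ> \<alpha> = \<alpha> ^^ (2 ^ n)"
    by (simp flip: funpow_Suc_right)
  ultimately show "hom_maltsev_admissible scale (derived_mult \<mu> \<alpha> n) (\<alpha> ^^ (2 ^ n))"
    by simp
qed

end
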